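(* Let $p$ be an odd prime and let $N_1,\dots,N_n$ be powers of $p$. If $A\subset \prod_{i=1}^n C_{N_i}$ is a set without 3-progressions, then $|A|\leq \prod_{i=1}^n \kappa_{N_i}$.
   Context: $C_N$ denotes the cyclic group of order $N$ in multiplicative notation. For a positive integer $N$, $\kappa_N=\min_{x>0} x^{-(N-1)/3}(1+x+\dots+x^{N-1})$. A 3-progression in an abelian group is a triple $x,y,z$ of (pairwise) different elements with $xy=z^2$; a set $A$ is without 3-progressions if it contains no such triple of elements. *)

theory Defs
  imports Complex_Main "HOL-Computational_Algebra.Primes" "HOL-Algebra.Elementary_Groups" "HOL-Algebra.Product_Groups"
begin

definition three_progression :: "('a, 'b) monoid_scheme \<Rightarrow> 'a \<Rightarrow> 'a \<Rightarrow> 'a \<Rightarrow> bool" where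
  "three_progression G x y z \<longleftrightarrow>
     x \<noteq> y \<and> y \<noteq> z \<and> x \<noteq> z \<and> x \<otimes>\<^bsub>G\<^esub> y = z [^]\<^bsub>G\<^esub> (2::nat)"

definition without_three_progressions :: "('a, 'b) monoid_scheme \<Rightarrow> 'a set \<Rightarrow> bool" where
  "without_three_progressions G A \<longleftrightarrow> \<not> (\<exists>x\<in>A. \<exists>y\<in>A. \<exists>z\<in>A. three_progression G x y z)"

definition kappa_fun :: "nat \<Rightarrow> real \<Rightarrow> real" where
  "kappa_fun N x = x powr (- (real N - 1) / 3) * (\<Sum>j<N. x ^ j)"

text \<open>
  The minimum over all positive reals, as the least element of the set of values. It exists
  for every positive \<open>N\<close> by \<open>kappa_fun_attains_min\<close> below.
\<close>

definition kappa :: "nat \<Rightarrow> real" where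
  "kappa N = (LEAST v. \<exists>x>0. v = kappa_fun N x)"

lemma kappa_fun_attains_min:
  assumes "N \<ge> 1"
  shows "\<exists>x>0. \<forall>y>0. kappa_fun N x \<le> kappa_fun N y"
proof (cases "N = 1")
  case True
  then show ?thesis by (intro exI[of _ 1]) (simp add: kappa_fun_def)
next
  case False
  with assms have N: "real N \<ge> 2" by simp
  define b where "b = real N powr 3"
  have b: "b \<ge> 1" using N unfolding b_def by (simp add: ge_one_powr_ge_zero)
  have "continuous_on {inverse b..b} (kappa_fun N)"
    unfolding kappa_fun_def using b by (intro continuous_intros) auto
  moreover have one: "1 \<in> {inverse b..b}" using b by (simp add: inverse_le_1_iff)
  ultimately obtain x where x: "x \<in> {inverse b..b}"
    and min: "\<And>y. y \<in> {inverse b..b} \<Longrightarrow> kappa_fun N x \<le> kappa_fun N y"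
    using continuous_attains_inf[of "{inverse b..b}" "kappa_fun N"] by auto
  have "inverse b > 0" using b by simp
  with x have xpos: "x > 0" by (meson atLeastAtMost_iff less_le_trans)
  have x1: "kappa_fun N x \<le> real N" using min[OF one] by (simp add: kappa_fun_def)
  have "kappa_fun N x \<le> kappa_fun N y" if y: "y > 0" for y
  proof -
    consider "y \<in> {inverse b..b}" | "y < inverse b" | "y > b" by fastforce
    then show ?thesis
    proof cases
      case 1
      then show ?thesis by (rule min)
    next
      case 2
      have "inverse y \<ge> b" using 2 y b by (simp add: field_simps)
      then have iy: "inverse y powr (1/3) \<ge> b powr (1/3)" "inverse y \<ge> 1"
        using b by (auto intro: powr_mono2)
      have "real N = b powr (1/3)" using N unfolding b_def powr_powr by simp
      also have "\<dots> \<le> inverse y powr (1/3)" by (rule iy)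
      also have "\<dots> \<le> inverse y powr ((real N - 1)/3)" using iy N by (intro powr_mono) auto
      also have "\<dots> = y powr (- (real N - 1)/3)" using y
        by (simp add: powr_def ln_inverse) (simp add: algebra_simps)
      also have "\<dots> \<le> kappa_fun N y"
      proof -
        have "y ^ 0 \<le> (\<Sum>j<N. y ^ j)" using y N by (intro member_le_sum) auto
        then show ?thesis unfolding kappa_fun_def using mult_left_mono[of 1 _ "y powr (- (real N - 1)/3)"] by simp
      qed
      finally show ?thesis using x1 by linarith
    next
      case 3
      with b have y1: "y \<ge> 1" by simp
      have "real N = b powr (1/3)" using N unfolding b_def powr_powr by simp
      also have "\<dots> \<le> y powr (1/3)" using 3 b by (intro powr_mono2) auto
      also have "\<dots> \<le> y powr (- (real N - 1)/3 + real (N - 1))" using y1 N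
        by (intro powr_mono) (auto simp: field_simps of_nat_diff)
      also have "\<dots> = y powr (- (real N - 1)/3) * y ^ (N - 1)" using y
        by (simp only: powr_add powr_realpow)
      also have "\<dots> \<le> kappa_fun N y"
      proof -
        have "y ^ (N - 1) \<le> (\<Sum>j<N. y ^ j)" using y N by (intro member_le_sum) auto
        then show ?thesis unfolding kappa_fun_def by (intro mult_left_mono) auto
      qed
      finally show ?thesis using x1 by linarith
    qed
  qed
  with xpos show ?thesis by blast
qed

lemma kappa_is_min:
  assumes "N \<ge> 1"
  shows "\<exists>x>0. kappa N = kappa_fun N x"
    and "\<And>y. y > 0 \<Longrightarrow> kappa N \<le> kappa_fun N y"
proof -
  obtain x where x: "x > 0" "\<And>y. y > 0 \<Longrightarrow> kappa_fun N x \<le> kappa_fun N y"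
    using kappa_fun_attains_min[OF assms] by blast
  have "kappa N = kappa_fun N x"
    unfolding kappa_def by (rule Least_equality) (use x in auto)
  with x show "\<exists>x>0. kappa N = kappa_fun N x"
    and "\<And>y. y > 0 \<Longrightarrow> kappa N \<le> kappa_fun N y" by auto
qed

end

theory Submission
  imports Defs "HOL-Number_Theory.Cong"
begin

text \<open>
  Modulo \<open>p\<close>, the indicator of \<open>N dvd m\<close> for a power \<open>N\<close> of \<open>p\<close> is the truncated alternating sum of the
  \<open>m choose j\<close> with \<open>j < N\<close>. By Vandermonde the indicator of \<open>x y = z\<^sup>2\<close> is thus a combination of terms
  \<open>f a x * f b y * f c (z\<^sup>-\<^sup>2)\<close> with \<open>a i + b i + c i < N i\<close> in every coordinate. Give degree \<open>j\<close> in
  coordinate \<open>i\<close> the weight \<open>\<xi> i ^ j\<close>, where \<open>\<xi> i \<le> 1\<close> is a minimiser for \<open>kappa (N i)\<close>; then one of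
  \<open>a\<close>, \<open>b\<close>, \<open>c\<close> has weight at least the cube root of \<open>\<Prod>i. \<xi> i ^ (N i - 1)\<close>, and at most
  \<open>\<Prod>i. kappa (N i)\<close> exponents do. The slice rank argument bounds the set by three times this number,
  and applying the bound to all powers of the set removes the factor 3.
\<close>

section \<open>Slice rank of diagonal tensors modulo a prime\<close>

text \<open>
  Gaussian elimination without division: off at most \<open>n\<close> points, a function orthogonal to \<open>L\<close> modulo \<open>q\<close>
  can be prescribed freely up to one unit \<open>c\<close>.
\<close>

lemma annihilator_mod_prime:
  fixes q :: int and L :: "('a \<Rightarrow> int) set"
  assumes q: "prime q" and "finite L" "card L \<le> n" "finite A"
  shows "\<exists>R\<subseteq>A. card R \<le> n \<and> (\<exists>c. \<not> q dvd c \<and>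
    (\<forall>u. \<exists>v. (\<forall>x\<in>A - R. v x = c * u x) \<and> (\<forall>f\<in>L. q dvd (\<Sum>x\<in>A. v x * f x))))"
  using assms(2-)
proof (induction n arbitrary: L A)
  case 0
  have "\<not> q dvd 1" using q not_prime_unit by blast
  with 0 show ?case by (intro exI[of _ "{}"]) (auto intro!: exI[of _ 1])
next
  case (Suc n)
  show ?case
  proof (cases "\<forall>f\<in>L. \<forall>x\<in>A. q dvd f x")
    case True
    have "\<not> q dvd 1" using q not_prime_unit by blast
    moreover have "\<forall>u. \<exists>v. (\<forall>x\<in>A - {}. v x = 1 * u x) \<and> (\<forall>f\<in>L. q dvd (\<Sum>x\<in>A. v x * f x))"
    proof
      fix u :: "'a \<Rightarrow> int"
      show "\<exists>v. (\<forall>x\<in>A - {}. v x = 1 * u x) \<and> (\<forall>f\<in>L. q dvd (\<Sum>x\<in>A. v x * f x))"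
        using True by (intro exI[of _ u]) (auto intro!: dvd_sum dvd_mult)
    qed
    ultimately show ?thesis by (intro exI[of _ "{}"] conjI exI[of _ 1]) auto
  next
    case False
    then obtain h a where h: "h \<in> L" "a \<in> A" "\<not> q dvd h a" by blast
    \<comment> \<open>Cross-multiplication with the pivot \<open>h a\<close> instead of division:
      every \<open>e f\<close> vanishes at \<open>a\<close>, and \<open>e h\<close> vanishes
      identically, so one function and one point drop out together.\<close>
    define e where "e f = (\<lambda>x. h a * f x - f a * h x)" for f
    have "card (e ` (L - {h})) \<le> card (L - {h})"
      using Suc.prems by (intro card_image_le) auto
    also have "\<dots> \<le> n" using Suc.prems h by simp
    finally have "card (e ` (L - {h})) \<le> n" .
    from Suc.IH[OF _ this, of "A - {a}"] Suc.prems obtain R c where R: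
      "R \<subseteq> A - {a}" "card R \<le> n" "\<not> q dvd c" and ex:
      "\<And>u. \<exists>v. (\<forall>x\<in>A - {a} - R. v x = c * u x) \<and> (\<forall>f\<in>e ` (L - {h}). q dvd (\<Sum>x\<in>A - {a}. v x * f x))"
      by auto
    have "\<exists>v. (\<forall>x\<in>A - insert a R. v x = h a * c * u x) \<and> (\<forall>f\<in>L. q dvd (\<Sum>x\<in>A. v x * f x))" for u
    proof -
      obtain v where v: "\<And>x. x \<in> A - {a} - R \<Longrightarrow> v x = c * u x"
        "\<And>f. f \<in> L - {h} \<Longrightarrow> q dvd (\<Sum>x\<in>A - {a}. v x * e f x)"
        using ex[of u] by blast
      \<comment> \<open>Back substitution: scaling \<open>v\<close> by \<open>h a\<close> leaves the
        value at \<open>a\<close> free, and it is chosen to make \<open>w\<close> orthogonal to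
        \<open>h\<close>. Pairing \<open>w\<close> with any \<open>f\<close> then amounts to pairing
        \<open>v\<close> with \<open>e f\<close>.\<close>
      define w where "w x = (if x = a then - (\<Sum>x\<in>A - {a}. v x * h x) else h a * v x)" for x
      have w: "(\<Sum>x\<in>A. w x * f x) = (\<Sum>x\<in>A - {a}. v x * e f x)" for f
      proof -
        have "(\<Sum>x\<in>A. w x * f x) = w a * f a + (\<Sum>x\<in>A - {a}. w x * f x)"
          using h Suc.prems by (intro sum.remove) auto
        also have "w a * f a = (\<Sum>x\<in>A - {a}. - (v x * h x * f a))"
          by (simp add: w_def sum_distrib_right sum_negf)
        also have "(\<Sum>x\<in>A - {a}. w x * f x) = (\<Sum>x\<in>A - {a}. h a * v x * f x)"
          by (intro sum.cong) (auto simp: w_def)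
        also have "(\<Sum>x\<in>A - {a}. - (v x * h x * f a)) + \<dots> = (\<Sum>x\<in>A - {a}. v x * e f x)"
          unfolding sum.distrib[symmetric] by (intro sum.cong) (auto simp: e_def algebra_simps)
        finally show ?thesis .
      qed
      have "e h = (\<lambda>x. 0)" by (auto simp: e_def)
      then have "q dvd (\<Sum>x\<in>A - {a}. v x * e f x)" if "f \<in> L" for f
        using v(2)[of f] that by (cases "f = h") auto
      then have "\<forall>f\<in>L. q dvd (\<Sum>x\<in>A. w x * f x)" by (simp add: w)
      moreover have "\<forall>x\<in>A - insert a R. w x = h a * c * u x"
        using v(1) by (auto simp: w_def)
      ultimately show ?thesis by blast
    qed
    moreover have "\<not> q dvd h a * c" using h R q by (simp add: prime_dvd_mult_iff)
    moreover have "card (insert a R) \<le> Suc n"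
      using R(1,2) Suc.prems(3) finite_subset[of R "A - {a}"] by (simp add: card_insert_if)
    moreover have "insert a R \<subseteq> A" using R h by auto
    ultimately show ?thesis by blast
  qed
qed

lemma sum_product3:
  fixes f g h :: "'a \<Rightarrow> 'b :: comm_semiring_0"
  shows "(\<Sum>(x, y, z)\<in>A \<times> A \<times> A. f x * (g y * h z)) = sum f A * (sum g A * sum h A)"
  by (simp add: sum.cartesian_product[symmetric] sum_distrib_left[symmetric] sum_distrib_right[symmetric])

text \<open>If \<open>A\<close> had more points, some \<open>b\<close> in \<open>A\<close> would
  avoid the exceptional sets of all three eliminations. Contracting the tensor with vectors
  orthogonal to \<open>L1\<close>, \<open>L2\<close> and \<open>L3\<close> gives 0 modulo
  \<open>q\<close> by \<open>cover\<close>, yet these vectors can be chosen so that only the nonzero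
  diagonal entry at \<open>b\<close> remains.\<close>

lemma diagonal_tensor_bound:
  fixes q :: int and F G H :: "'s \<Rightarrow> 'a \<Rightarrow> int"
  assumes q: "prime q" and fin: "finite A" "finite L1" "finite L2" "finite L3"
    and cover: "\<And>s. s \<in> Q \<Longrightarrow> F s \<in> L1 \<or> G s \<in> L2 \<or> H s \<in> L3"
    and off_diag: "\<And>x y z. x \<in> A \<Longrightarrow> y \<in> A \<Longrightarrow> z \<in> A \<Longrightarrow> \<not> (x = y \<and> y = z) \<Longrightarrow>
      q dvd (\<Sum>s\<in>Q. F s x * G s y * H s z)"
    and diag: "\<And>x. x \<in> A \<Longrightarrow> \<not> q dvd (\<Sum>s\<in>Q. F s x * G s x * H s x)"
  shows "card A \<le> card L1 + card L2 + card L3"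
proof (rule ccontr)
  assume less: "\<not> ?thesis"
  obtain R3 c3 where R3: "R3 \<subseteq> A" "card R3 \<le> card L3" "\<not> q dvd c3" and
    ex3: "\<And>u. \<exists>v. (\<forall>x\<in>A - R3. v x = c3 * u x) \<and> (\<forall>f\<in>L3. q dvd (\<Sum>x\<in>A. v x * f x))"
    using annihilator_mod_prime[OF q fin(4) order_refl fin(1)] by auto
  obtain R2 c2 where R2: "R2 \<subseteq> A" "card R2 \<le> card L2" "\<not> q dvd c2" and
    ex2: "\<And>u. \<exists>v. (\<forall>x\<in>A - R2. v x = c2 * u x) \<and> (\<forall>f\<in>L2. q dvd (\<Sum>x\<in>A. v x * f x))"
    using annihilator_mod_prime[OF q fin(3) order_refl fin(1)] by auto
  \<comment> \<open>This elimination runs on \<open>A - R3\<close> only, so that its vector stays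
    orthogonal to \<open>L1\<close> when extended by zero to \<open>R3\<close>, where the third
    vector is not controlled.\<close>
  obtain R1 c1 where R1: "R1 \<subseteq> A - R3" "card R1 \<le> card L1" "\<not> q dvd c1" and
    ex1: "\<And>u. \<exists>v. (\<forall>x\<in>A - R3 - R1. v x = c1 * u x) \<and> (\<forall>f\<in>L1. q dvd (\<Sum>x\<in>A - R3. v x * f x))"
    using annihilator_mod_prime[OF q fin(2) order_refl, of "A - R3"] fin(1) by auto
  have "card (R1 \<union> R2 \<union> R3) \<le> card R1 + card R2 + card R3"
    using card_Un_le[of "R1 \<union> R2" R3] card_Un_le[of R1 R2] by linarith
  then have "card (R1 \<union> R2 \<union> R3) < card A" using less R1(2) R2(2) R3(2) by linarith
  moreover have "finite (R1 \<union> R2 \<union> R3)"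
    using R1(1) R2(1) R3(1) fin(1) by (auto intro: finite_subset)
  ultimately have "\<not> A \<subseteq> R1 \<union> R2 \<union> R3"
    using card_mono[of "R1 \<union> R2 \<union> R3" A] by auto
  then obtain b where b: "b \<in> A" "b \<notin> R1" "b \<notin> R2" "b \<notin> R3" by blast
  obtain v1 where v1: "\<And>x. x \<in> A - R3 - R1 \<Longrightarrow> v1 x = c1 * 1"
    "\<And>f. f \<in> L1 \<Longrightarrow> q dvd (\<Sum>x\<in>A - R3. v1 x * f x)" using ex1[of "\<lambda>_. 1"] by auto
  obtain v2 where v2: "\<And>x. x \<in> A - R2 \<Longrightarrow> v2 x = c2 * 1"
    "\<And>f. f \<in> L2 \<Longrightarrow> q dvd (\<Sum>x\<in>A. v2 x * f x)" using ex2[of "\<lambda>_. 1"] by auto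
  obtain v3 where v3: "\<And>x. x \<in> A - R3 \<Longrightarrow> v3 x = c3 * (if x = b then 1 else 0)"
    "\<And>f. f \<in> L3 \<Longrightarrow> q dvd (\<Sum>x\<in>A. v3 x * f x)"
    using ex3[of "\<lambda>x. if x = b then 1 else 0"] by auto
  \<comment> \<open>\<open>w\<close> vanishes on \<open>R3\<close> and \<open>v3\<close> off \<open>insert b R3\<close>, so only the diagonal entry at \<open>b\<close> survives in \<open>S\<close>\<close>
  define w where "w x = (if x \<in> R3 then 0 else v1 x)" for x
  have w: "(\<Sum>x\<in>A. w x * f x) = (\<Sum>x\<in>A - R3. v1 x * f x)" for f
    using fin(1) by (intro sum.mono_neutral_cong_right) (auto simp: w_def)
  define T where "T x y z = (\<Sum>s\<in>Q. F s x * G s y * H s z)" for x y z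
  define S where "S = (\<Sum>(x, y, z)\<in>A \<times> A \<times> A. w x * v2 y * v3 z * T x y z)"
  have "S = (\<Sum>s\<in>Q. \<Sum>(x, y, z)\<in>A \<times> A \<times> A. w x * v2 y * v3 z * (F s x * G s y * H s z))"
    unfolding S_def T_def sum_distrib_left case_prod_unfold by (rule sum.swap)
  also have "\<dots> = (\<Sum>s\<in>Q. (\<Sum>x\<in>A. w x * F s x) * ((\<Sum>y\<in>A. v2 y * G s y) * (\<Sum>z\<in>A. v3 z * H s z)))"
    unfolding sum_product3[symmetric] by (intro sum.cong refl) (auto simp: mult_ac)
  also have "q dvd \<dots>"
  proof (rule dvd_sum)
    fix s assume "s \<in> Q"
    from cover[OF this] show "q dvd (\<Sum>x\<in>A. w x * F s x) * ((\<Sum>y\<in>A. v2 y * G s y) * (\<Sum>z\<in>A. v3 z * H s z))"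
      using v1(2) v2(2) v3(2) by (auto simp: w)
  qed
  finally have "q dvd S" .
  moreover have "S = w b * v2 b * v3 b * T b b b +
      (\<Sum>(x, y, z)\<in>A \<times> A \<times> A - {(b, b, b)}. w x * v2 y * v3 z * T x y z)"
    unfolding S_def using b fin(1) by (subst sum.remove[of _ "(b, b, b)"]) auto
  moreover have "q dvd (\<Sum>(x, y, z)\<in>A \<times> A \<times> A - {(b, b, b)}. w x * v2 y * v3 z * T x y z)"
  proof (rule dvd_sum)
    fix t assume "t \<in> A \<times> A \<times> A - {(b, b, b)}"
    then obtain x y z where t: "t = (x, y, z)"
      and A: "x \<in> A" "y \<in> A" "z \<in> A" "\<not> (x = b \<and> y = b \<and> z = b)" by auto
    have "q dvd w x * v2 y * v3 z * T x y z"
    proof (cases "x = y \<and> y = z")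
      case True
      then have "w x * v3 z = 0" using A v3(1) by (auto simp: w_def)
      then show ?thesis by auto
    next
      case False
      then show ?thesis using off_diag A by (auto simp: T_def)
    qed
    then show "q dvd (case t of (x, y, z) \<Rightarrow> w x * v2 y * v3 z * T x y z)" by (simp add: t)
  qed
  ultimately have "q dvd w b * v2 b * v3 b * T b b b" by (simp add: dvd_add_left_iff)
  moreover have "w b = c1" "v2 b = c2" "v3 b = c3"
    using b v1(1) v2(1) v3(1) by (auto simp: w_def)
  ultimately show False
    using R1(3) R2(3) R3(3) diag[OF b(1)] q by (simp add: prime_dvd_mult_iff T_def)
qed

section \<open>Binomial coefficients modulo \<open>p\<close> and the divisibility indicator\<close>

text \<open>By absorption \<open>p ^ k\<close> divides \<open>i * (p ^ k choose i)\<close>. Were the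
  second factor prime to \<open>p\<close>, then \<open>p ^ k\<close> would divide the smaller
  positive number \<open>i\<close>.\<close>

lemma prime_dvd_choose_prime_power:
  fixes p :: nat
  assumes p: "prime p" and i: "0 < i" "i < p ^ k"
  shows "p dvd (p ^ k choose i)"
proof (rule ccontr)
  assume "\<not> p dvd (p ^ k choose i)"
  then have cop: "coprime (p ^ k) (p ^ k choose i)"
    using p by (intro coprime_power_left_iff[THEN iffD2]) (auto intro: prime_imp_coprime)
  have "i * (p ^ k choose i) = p ^ k * (p ^ k - 1 choose (i - 1))"
    using i binomial_absorption[of "i - 1" "p ^ k"] by simp
  then have "p ^ k dvd i * (p ^ k choose i)" by simp
  with cop have "p ^ k dvd i" by (simp add: coprime_dvd_mult_left_iff)
  then show False using i by (auto dest: dvd_imp_le)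
qed

text \<open>Coefficient form of \<open>(1 + X) ^ (p ^ k) = 1 + X ^ (p ^ k)\<close> modulo
  \<open>p\<close>: below degree \<open>p ^ k\<close> only the term \<open>i = 0\<close> of the
  Vandermonde sum survives.\<close>

lemma choose_add_prime_power_cong:
  fixes p :: nat
  assumes p: "prime p" and j: "j < p ^ k"
  shows "[p ^ k + m choose j = m choose j] (mod p)"
proof -
  have "(p ^ k + m choose j) = (\<Sum>i\<le>j. (p ^ k choose i) * (m choose (j - i)))"
    by (rule vandermonde[symmetric])
  also have "\<dots> = (m choose j) + (\<Sum>i\<in>{..j} - {0}. (p ^ k choose i) * (m choose (j - i)))"
    by (subst sum.remove[of _ 0]) auto
  also have "[\<dots> = (m choose j) + 0] (mod p)"
  proof (intro cong_add cong_refl, unfold cong_0_iff, rule dvd_sum)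
    fix i assume "i \<in> {..j} - {0}"
    then show "p dvd (p ^ k choose i) * (m choose (j - i))"
      using prime_dvd_choose_prime_power[OF p, of i k] j by auto
  qed
  finally show ?thesis by simp
qed

text \<open>Modulo \<open>p\<close> both sides have period \<open>p ^ k\<close> in \<open>m\<close>,
  which reduces the claim to \<open>m < p ^ k\<close>. There the truncation cuts off only zeros, and
  the full alternating sum is \<open>(1 - 1) ^ m\<close>.\<close>

lemma alternating_choose_sum_cong:
  fixes p :: nat
  assumes p: "prime p"
  shows "[(\<Sum>j<p ^ k. (- 1) ^ j * int (m choose j)) = (if p ^ k dvd m then 1 else 0)] (mod int p)"
proof (induction m rule: less_induct)
  case (less m)
  have pk: "p ^ k > 0" using prime_gt_0_nat[OF p] by simp
  show ?case
  proof (cases "m < p ^ k")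
    case True
    have "(\<Sum>j<p ^ k. (- 1) ^ j * int (m choose j)) = (\<Sum>j\<le>m. (- 1) ^ j * int (m choose j))"
      using True by (intro sum.mono_neutral_right) auto
    also have "\<dots> = (if p ^ k dvd m then 1 else 0)"
    proof (cases "m = 0")
      case False
      then have "\<not> p ^ k dvd m" using True by (auto dest: dvd_imp_le)
      with False show ?thesis using choose_alternating_sum[of m, where ?'a = int] by simp
    qed simp
    finally show ?thesis by simp
  next
    case False
    define d where "d = m - p ^ k"
    have m: "m = p ^ k + d" using False by (simp add: d_def)
    have "[(\<Sum>j<p ^ k. (- 1) ^ j * int (m choose j)) = (\<Sum>j<p ^ k. (- 1) ^ j * int (d choose j))] (mod int p)"
      using choose_add_prime_power_cong[OF p] unfolding m
      by (intro cong_sum cong_mult cong_refl) (auto simp: cong_int_iff)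
    also have "[(\<Sum>j<p ^ k. (- 1) ^ j * int (d choose j)) = (if p ^ k dvd d then 1 else 0)] (mod int p)"
      using less.IH[of d] m pk by simp
    finally show ?thesis by (simp add: m)
  qed
qed

definition simplex_points :: "nat \<Rightarrow> (nat \<times> nat \<times> nat) set" where
  "simplex_points N = {(a, b, c). a + b + c < N}"

lemma finite_simplex_points: "finite (simplex_points N)"
  by (rule finite_subset[of _ "{..N} \<times> {..N} \<times> {..N}"]) (auto simp: simplex_points_def)

text \<open>Vandermonde applied twice; the sign is multiplicative because
  \<open>j = a + b + c\<close>. The bound \<open>j < N\<close> becomes the constraint on total
  degree that makes one of the three factors small.\<close>

lemma alternating_choose_sum_add3:
  "(\<Sum>j<N. (- 1) ^ j * int (x + y + z choose j)) =
   (\<Sum>(a, b, c)\<in>simplex_points N.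
      ((- 1) ^ a * int (x choose a)) * ((- 1) ^ b * int (y choose b)) * ((- 1) ^ c * int (z choose c)))"
proof -
  have "(- 1) ^ j * int (x + y + z choose j) =
    (\<Sum>(a, b)\<in>(SIGMA a:{..j}. {..j - a}). (- 1) ^ j *
      (int (x choose a) * int (y choose b) * int (z choose (j - a - b))))" for j
    unfolding sum.Sigma[OF finite_atMost ballI[OF finite_atMost], symmetric] add.assoc
    by (simp add: vandermonde[symmetric] sum_distrib_left mult_ac)
  then have "(\<Sum>j<N. (- 1) ^ j * int (x + y + z choose j)) =
    (\<Sum>(j, a, b)\<in>(SIGMA j:{..<N}. SIGMA a:{..j}. {..j - a}). (- 1) ^ j *
      (int (x choose a) * int (y choose b) * int (z choose (j - a - b))))"
    by (simp add: sum.Sigma)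
  also have "\<dots> = (\<Sum>(a, b, c)\<in>simplex_points N.
      ((- 1) ^ a * int (x choose a)) * ((- 1) ^ b * int (y choose b)) * ((- 1) ^ c * int (z choose c)))"
    by (rule sum.reindex_bij_witness[of _ "\<lambda>(a, b, c). (a + b + c, a, b)" "\<lambda>(j, a, b). (a, b, j - a - b)"])
      (auto simp: simplex_points_def power_add[symmetric])
  finally show ?thesis .
qed

section \<open>Minimisers for \<open>kappa\<close> and the number of heavy exponents\<close>

text \<open>Reversing the polynomial shows that \<open>kappa_fun N (1 / x)\<close> is the same sum
  with prefactor exponent \<open>-2(N-1)/3\<close> in place of \<open>-(N-1)/3\<close>. For
  \<open>x > 1\<close> this is no larger, so a minimiser above 1 may be replaced by its
  inverse.\<close>

lemma kappa_attained_below_one: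
  assumes N: "N \<ge> 1"
  obtains x where "0 < x" "x \<le> 1" "kappa N = kappa_fun N x"
proof -
  obtain x where x: "x > 0" "kappa N = kappa_fun N x" using kappa_is_min(1)[OF N] by auto
  show ?thesis
  proof (cases "x \<le> 1")
    case False
    have "(\<Sum>j<N. (1 / x) ^ j) = (\<Sum>j<N. x powr (- (real N - 1)) * x ^ j)"
    proof (rule sum.reindex_bij_witness[of _ "\<lambda>j. N - 1 - j" "\<lambda>j. N - 1 - j"])
      fix j assume j: "j \<in> {..<N}"
      have "x powr (- (real N - 1)) * x ^ (N - 1 - j) = x powr (- (real N - 1) + real (N - 1 - j))"
        using x by (simp only: powr_add powr_realpow)
      also have "- (real N - 1) + real (N - 1 - j) = - real j" using j by (simp add: of_nat_diff)
      also have "x powr (- real j) = (1 / x) ^ j"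
        using x by (simp add: powr_minus powr_realpow field_simps)
      finally show "x powr (- (real N - 1)) * x ^ (N - 1 - j) = (1 / x) ^ j" .
    qed auto
    then have "kappa_fun N (1 / x) =
        (1 / x) powr (- (real N - 1) / 3) * x powr (- (real N - 1)) * (\<Sum>j<N. x ^ j)"
      by (simp add: kappa_fun_def sum_distrib_left mult.assoc)
    also have "(1 / x) powr (- (real N - 1) / 3) = x powr ((real N - 1) / 3)"
      using x by (simp add: powr_def ln_div algebra_simps)
    also have "\<dots> * x powr (- (real N - 1)) = x powr (- (2 * (real N - 1) / 3))"
    proof -
      have "(real N - 1) / 3 + - (real N - 1) = - (2 * (real N - 1) / 3)" by (simp add: field_simps)
      then show ?thesis by (simp only: powr_add[symmetric])
    qed
    also have "\<dots> * (\<Sum>j<N. x ^ j) \<le> kappa_fun N x"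
      unfolding kappa_fun_def using False N
      by (intro mult_right_mono powr_mono sum_nonneg) (auto simp: field_simps)
    finally have "kappa_fun N (1 / x) \<le> kappa_fun N x" .
    with kappa_is_min(2)[OF N, of "1 / x"] x have "kappa N = kappa_fun N (1 / x)" by auto
    with False x show ?thesis by (intro that[of "1 / x"]) (auto simp: field_simps)
  qed (use x that in blast)
qed

lemma kappa_pos: "N \<ge> 1 \<Longrightarrow> kappa N > 0"
proof -
  assume N: "N \<ge> 1"
  obtain x where x: "x > 0" "kappa N = kappa_fun N x" using kappa_is_min(1)[OF N] by auto
  have "(\<Sum>j<N. x ^ j) > 0" using N x by (intro sum_pos) (auto simp: lessThan_empty_iff)
  then show ?thesis using x by (simp add: kappa_fun_def)
qed

text \<open>A Markov-type estimate: the weight of an exponent divided by the threshold is at least 1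
  on \<open>L\<close> and nonnegative elsewhere, and its sum over all exponents factors into the
  values of \<open>kappa_fun\<close>.\<close>

lemma card_light_exponents_le:
  fixes \<xi> :: "'i \<Rightarrow> real" and N :: "'i \<Rightarrow> nat"
  assumes I: "finite I" and \<xi>: "\<And>i. i \<in> I \<Longrightarrow> \<xi> i > 0"
  defines "L \<equiv> {a \<in> PiE I (\<lambda>i. {..<N i}).
    (\<Prod>i\<in>I. \<xi> i powr ((real (N i) - 1) / 3)) \<le> (\<Prod>i\<in>I. \<xi> i ^ a i)}"
  shows "real (card L) \<le> (\<Prod>i\<in>I. kappa_fun (N i) (\<xi> i))"
proof -
  let ?P = "PiE I (\<lambda>i. {..<N i})"
  let ?g = "\<lambda>a. \<Prod>i\<in>I. \<xi> i powr (- (real (N i) - 1) / 3) * \<xi> i ^ a i"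
  have fin: "finite ?P" using I by (intro finite_PiE) auto
  have "real (card L) = (\<Sum>a\<in>L. 1)" by simp
  also have "\<dots> \<le> (\<Sum>a\<in>L. ?g a)"
  proof (rule sum_mono)
    fix a assume a: "a \<in> L"
    have "\<xi> i \<noteq> 0" if "i \<in> I" for i using \<xi>[OF that] by simp
    then have pos: "0 < (\<Prod>i\<in>I. \<xi> i powr ((real (N i) - 1) / 3))" by (intro prod_pos) simp
    have "?g a = (\<Prod>i\<in>I. \<xi> i ^ a i / \<xi> i powr ((real (N i) - 1) / 3))"
    proof (rule prod.cong[OF refl])
      fix i
      have "- (real (N i) - 1) / 3 = - ((real (N i) - 1) / 3)" by (simp add: field_simps)
      then show "\<xi> i powr (- (real (N i) - 1) / 3) * \<xi> i ^ a i = \<xi> i ^ a i / \<xi> i powr ((real (N i) - 1) / 3)"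
        by (simp only: powr_minus divide_inverse mult.commute)
    qed
    also have "\<dots> = (\<Prod>i\<in>I. \<xi> i ^ a i) / (\<Prod>i\<in>I. \<xi> i powr ((real (N i) - 1) / 3))"
      by (rule prod_dividef)
    also have "1 \<le> \<dots>" using a pos by (simp add: L_def le_divide_eq)
    finally show "1 \<le> ?g a" .
  qed
  also have "\<dots> \<le> (\<Sum>a\<in>?P. ?g a)"
    using fin \<xi> by (intro sum_mono2 prod_nonneg) (auto simp: L_def less_imp_le)
  also have "\<dots> = (\<Prod>i\<in>I. kappa_fun (N i) (\<xi> i))"
    unfolding kappa_fun_def sum_distrib_left using I by (intro prod_sum_PiE[symmetric]) auto
  finally show ?thesis .
qed

section \<open>The bound with the factor 3 and its removal by powers\<close>

text \<open>Residues are represented by integers. As \<open>free\<close> leaves only constant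
  solutions, the indicator of \<open>x + y = 2 z\<close> is the diagonal tensor on \<open>A\<close>.
  Each of the three families of slices has at most \<open>card L\<close> members, whence the factor
  3.\<close>

lemma progression_free_card_le_3:
  fixes A :: "('i \<Rightarrow> int) set"
  assumes I: "finite I" and p: "prime p" and N: "\<And>i. i \<in> I \<Longrightarrow> \<exists>k. N i = p ^ k"
    and A: "A \<subseteq> PiE I (\<lambda>i. {0..<int (N i)})"
    and free: "\<And>x y z. x \<in> A \<Longrightarrow> y \<in> A \<Longrightarrow> z \<in> A \<Longrightarrow>
      (\<And>i. i \<in> I \<Longrightarrow> [x i + y i = 2 * z i] (mod int (N i))) \<Longrightarrow> x = y \<and> y = z"
  shows "real (card A) \<le> 3 * (\<Prod>i\<in>I. kappa (N i))"
proof -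
  have N1: "N i \<ge> 1" if "i \<in> I" for i
    using N[OF that] prime_gt_0_nat[OF p] by (auto simp: Suc_le_eq)
  have "\<exists>x. 0 < x \<and> x \<le> 1 \<and> kappa (N i) = kappa_fun (N i) x" if "i \<in> I" for i
    using kappa_attained_below_one[OF N1[OF that]] by metis
  then obtain \<xi> where \<xi>: "\<And>i. i \<in> I \<Longrightarrow> 0 < \<xi> i \<and> \<xi> i \<le> 1 \<and> kappa (N i) = kappa_fun (N i) (\<xi> i)"
    by metis
  define \<theta> where "\<theta> = (\<Prod>i\<in>I. \<xi> i powr ((real (N i) - 1) / 3))"
  define L where "L = {a \<in> PiE I (\<lambda>i. {..<N i}). \<theta> \<le> (\<Prod>i\<in>I. \<xi> i ^ a i)}"
  have finL: "finite L" 
    by (rule finite_subset[of _ "PiE I (\<lambda>i. {..<N i})"]) (use I in \<open>auto simp: L_def intro: finite_PiE\<close>)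
  have cardL: "real (card L) \<le> (\<Prod>i\<in>I. kappa (N i))"
    using card_light_exponents_le[OF I, of \<xi> N] \<xi> by (simp add: L_def \<theta>_def)
  have finA: "finite A" by (rule finite_subset[OF A]) (use I in \<open>auto intro: finite_PiE\<close>)
  define f where "f a x = (\<Prod>i\<in>I. (- 1) ^ a i * int (nat (x i) choose a i))" for a :: "'i \<Rightarrow> nat" and x
  \<comment> \<open>\<open>- 2 * z i\<close> shifted to be nonnegative, as \<open>f\<close> truncates by \<open>nat\<close>\<close>
  define neg where "neg z = (\<lambda>i. 2 * int (N i) - 2 * z i)" for z
  define Q where "Q = PiE I (\<lambda>i. simplex_points (N i))"
  define s1 where "s1 s = (\<lambda>i\<in>I. fst (s i))" for s :: "'i \<Rightarrow> nat \<times> nat \<times> nat"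
  define s2 where "s2 s = (\<lambda>i\<in>I. fst (snd (s i)))" for s :: "'i \<Rightarrow> nat \<times> nat \<times> nat"
  define s3 where "s3 s = (\<lambda>i\<in>I. snd (snd (s i)))" for s :: "'i \<Rightarrow> nat \<times> nat \<times> nat"
  \<comment> \<open>If all three weights were below \<open>\<theta>\<close>, their product would be
    below \<open>\<theta> * \<theta> * \<theta>\<close>, the weight of the degrees
    \<open>N i - 1\<close>. But the total degree is at most \<open>N i - 1\<close> in each
    coordinate, and powers of \<open>\<xi> i \<le> 1\<close> decrease.\<close>
  have light: "s1 s \<in> L \<or> s2 s \<in> L \<or> s3 s \<in> L" if s: "s \<in> Q" for s
  proof (rule ccontr)
    assume not: "\<not> ?thesis"
    have si: "fst (s i) + fst (snd (s i)) + snd (snd (s i)) < N i" if "i \<in> I" for i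
      using s that by (force simp: Q_def simplex_points_def)
    then have "s1 s \<in> PiE I (\<lambda>i. {..<N i})" "s2 s \<in> PiE I (\<lambda>i. {..<N i})" "s3 s \<in> PiE I (\<lambda>i. {..<N i})"
      unfolding s1_def s2_def s3_def by fastforce+
    with not have lt: "(\<Prod>i\<in>I. \<xi> i ^ s1 s i) < \<theta>" "(\<Prod>i\<in>I. \<xi> i ^ s2 s i) < \<theta>" "(\<Prod>i\<in>I. \<xi> i ^ s3 s i) < \<theta>"
      by (auto simp: L_def)
    have nn: "0 \<le> (\<Prod>i\<in>I. \<xi> i ^ a i)" for a :: "'i \<Rightarrow> nat"
      using \<xi> by (intro prod_nonneg) (auto simp: less_imp_le)
    have "(\<Prod>i\<in>I. \<xi> i ^ s1 s i) * (\<Prod>i\<in>I. \<xi> i ^ s2 s i) * (\<Prod>i\<in>I. \<xi> i ^ s3 s i) < \<theta> * \<theta> * \<theta>"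
      using lt nn by (intro mult_strict_mono') auto
    also have "\<theta> * \<theta> * \<theta> = (\<Prod>i\<in>I. \<xi> i ^ (N i - 1))"
      unfolding \<theta>_def prod.distrib[symmetric]
    proof (rule prod.cong[OF refl])
      fix i assume i: "i \<in> I"
      have "\<xi> i powr ((real (N i) - 1) / 3) * \<xi> i powr ((real (N i) - 1) / 3) * \<xi> i powr ((real (N i) - 1) / 3)
        = \<xi> i powr ((real (N i) - 1) / 3 + (real (N i) - 1) / 3 + (real (N i) - 1) / 3)"
        by (simp only: powr_add)
      also have "(real (N i) - 1) / 3 + (real (N i) - 1) / 3 + (real (N i) - 1) / 3 = real (N i - 1)"
        using N1[OF i] by (simp add: of_nat_diff field_simps)
      finally show "\<xi> i powr ((real (N i) - 1) / 3) * \<xi> i powr ((real (N i) - 1) / 3) * \<xi> i powr ((real (N i) - 1) / 3)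
        = \<xi> i ^ (N i - 1)" using \<xi>[OF i] by (simp add: powr_realpow)
    qed
    also have "\<dots> \<le> (\<Prod>i\<in>I. \<xi> i ^ (s1 s i + s2 s i + s3 s i))"
    proof (rule prod_mono, intro conjI)
      fix i assume i: "i \<in> I"
      show "0 \<le> \<xi> i ^ (N i - 1)" using \<xi>[OF i] by simp
      show "\<xi> i ^ (N i - 1) \<le> \<xi> i ^ (s1 s i + s2 s i + s3 s i)"
        using \<xi>[OF i] si[OF i] i by (intro power_decreasing) (auto simp: s1_def s2_def s3_def)
    qed
    finally show False by (simp add: power_add prod.distrib)
  qed
  have tensor: "[(\<Sum>s\<in>Q. f (s1 s) x * f (s2 s) y * f (s3 s) (neg z)) =
      (if \<forall>i\<in>I. [x i + y i = 2 * z i] (mod int (N i)) then 1 else 0)] (mod int p)"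
    if xyz: "x \<in> A" "y \<in> A" "z \<in> A" for x y z
  proof -
    define m where "m i = nat (x i) + nat (y i) + nat (neg z i)" for i
    have dvd: "N i dvd m i \<longleftrightarrow> [x i + y i = 2 * z i] (mod int (N i))" if i: "i \<in> I" for i
    proof -
      have "0 \<le> x i" "0 \<le> y i" "z i < int (N i)" using xyz A i by fastforce+
      then have "int (m i) = x i + y i - 2 * z i + int (N i) * 2" by (simp add: m_def neg_def)
      then have "int (N i) dvd int (m i) \<longleftrightarrow> int (N i) dvd x i + y i - 2 * z i"
        by (simp add: dvd_add_left_iff)
      then show ?thesis by (simp add: cong_iff_dvd_diff)
    qed
    have "(\<Sum>s\<in>Q. f (s1 s) x * f (s2 s) y * f (s3 s) (neg z)) =
      (\<Sum>s\<in>Q. \<Prod>i\<in>I. case s i of (a, b, c) \<Rightarrow> ((- 1) ^ a * int (nat (x i) choose a)) *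
        ((- 1) ^ b * int (nat (y i) choose b)) * ((- 1) ^ c * int (nat (neg z i) choose c)))"
      unfolding f_def prod.distrib[symmetric]
      by (intro sum.cong prod.cong) (auto simp: s1_def s2_def s3_def split: prod.splits)
    also have "\<dots> = (\<Prod>i\<in>I. \<Sum>(a, b, c)\<in>simplex_points (N i). ((- 1) ^ a * int (nat (x i) choose a)) *
        ((- 1) ^ b * int (nat (y i) choose b)) * ((- 1) ^ c * int (nat (neg z i) choose c)))"
      unfolding Q_def using I finite_simplex_points by (intro prod_sum_PiE[symmetric]) auto
    also have "\<dots> = (\<Prod>i\<in>I. \<Sum>j<N i. (- 1) ^ j * int (m i choose j))"
      by (simp only: alternating_choose_sum_add3 m_def)
    \<comment> \<open>This is where each \<open>N i\<close> must be a power of the same prime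
      \<open>p\<close>: all coordinates are reduced modulo one field characteristic.\<close>
    also have "[\<dots> = (\<Prod>i\<in>I. if N i dvd m i then 1 else 0)] (mod int p)"
    proof (rule cong_prod)
      fix i assume "i \<in> I"
      then obtain k where "N i = p ^ k" using N by blast
      then show "[(\<Sum>j<N i. (- 1) ^ j * int (m i choose j)) = (if N i dvd m i then 1 else 0)] (mod int p)"
        using alternating_choose_sum_cong[OF p] by simp
    qed
    also have "(\<Prod>i\<in>I. if N i dvd m i then 1 else 0) =
        (if \<forall>i\<in>I. [x i + y i = 2 * z i] (mod int (N i)) then 1 else (0 :: int))"
      using I dvd by (auto simp: prod_zero_iff)
    finally show ?thesis .
  qed
  have q: "prime (int p)" using p by simp
  have "card A \<le> card (f ` L) + card (f ` L) + card ((\<lambda>a z. f a (neg z)) ` L)"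
  proof (rule diagonal_tensor_bound[OF q finA])
    fix s assume "s \<in> Q"
    from light[OF this] show "f (s1 s) \<in> f ` L \<or> f (s2 s) \<in> f ` L \<or>
        (\<lambda>z. f (s3 s) (neg z)) \<in> (\<lambda>a z. f a (neg z)) ` L" by auto
  next
    fix x y z assume xyz: "x \<in> A" "y \<in> A" "z \<in> A" "\<not> (x = y \<and> y = z)"
    then have "\<not> (\<forall>i\<in>I. [x i + y i = 2 * z i] (mod int (N i)))" using free[of x y z] by blast
    then show "int p dvd (\<Sum>s\<in>Q. f (s1 s) x * f (s2 s) y * f (s3 s) (neg z))"
      using tensor[OF xyz(1-3)] by (simp only: if_False cong_0_iff)
  next
    fix x assume "x \<in> A"
    from tensor[OF this this this]
    have "[(\<Sum>s\<in>Q. f (s1 s) x * f (s2 s) x * f (s3 s) (neg x)) = 1] (mod int p)" by simp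
    then show "\<not> int p dvd (\<Sum>s\<in>Q. f (s1 s) x * f (s2 s) x * f (s3 s) (neg x))"
      using not_prime_unit[of "int p"] q by (auto dest: cong_dvd_iff)
  qed (use finL in auto)
  also have "\<dots> \<le> card L + card L + card L" using finL by (intro add_mono card_image_le)
  finally show ?thesis using cardL by linarith
qed

text \<open>The \<open>m\<close>-th power of \<open>A\<close> satisfies the same hypotheses over
  \<open>m\<close> copies of \<open>I\<close>, so \<open>(card A / K) ^ m \<le> 3\<close> for every
  \<open>m\<close>, which forces \<open>card A \<le> K\<close>.\<close>

lemma progression_free_card_le:
  fixes A :: "('i \<Rightarrow> int) set"
  assumes I: "finite I" and p: "prime p" and N: "\<And>i. i \<in> I \<Longrightarrow> \<exists>k. N i = p ^ k"
    and A: "A \<subseteq> PiE I (\<lambda>i. {0..<int (N i)})"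
    and free: "\<And>x y z. x \<in> A \<Longrightarrow> y \<in> A \<Longrightarrow> z \<in> A \<Longrightarrow>
      (\<And>i. i \<in> I \<Longrightarrow> [x i + y i = 2 * z i] (mod int (N i))) \<Longrightarrow> x = y \<and> y = z"
  shows "real (card A) \<le> (\<Prod>i\<in>I. kappa (N i))"
proof -
  define K where "K = (\<Prod>i\<in>I. kappa (N i))"
  have "N i \<ge> 1" if "i \<in> I" for i
    using N[OF that] prime_gt_0_nat[OF p] by (auto simp: Suc_le_eq)
  then have K: "K > 0" unfolding K_def by (intro prod_pos kappa_pos) auto
  have power: "real (card A) ^ m \<le> 3 * K ^ m" for m
  proof -
    define J where "J = {..<m} \<times> I"
    \<comment> \<open>Flattens an \<open>m\<close>-tuple of points of \<open>A\<close> into a single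
      function on \<open>J\<close>; \<open>inj\<close> ensures that no tuples are
      identified.\<close>
    define h where "h g = (\<lambda>(t, i)\<in>J. g t i)" for g :: "nat \<Rightarrow> 'i \<Rightarrow> int"
    have inj: "g = g'" if g: "g \<in> PiE {..<m} (\<lambda>_. A)" "g' \<in> PiE {..<m} (\<lambda>_. A)" and eq: "h g = h g'" for g g'
    proof (rule PiE_ext[OF g])
      fix t assume t: "t \<in> {..<m}"
      have "g t \<in> PiE I (\<lambda>i. {0..<int (N i)})" "g' t \<in> PiE I (\<lambda>i. {0..<int (N i)})"
        using g t A by auto
      then show "g t = g' t"
      proof (rule PiE_ext)
        fix i assume "i \<in> I"
        then show "g t i = g' t i" using fun_cong[OF eq, of "(t, i)"] t by (simp add: h_def J_def)
      qed
    qed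
    have "real (card (h ` PiE {..<m} (\<lambda>_. A))) \<le> 3 * (\<Prod>j\<in>J. kappa (N (snd j)))"
    proof (rule progression_free_card_le_3[OF _ p])
      show "finite J" using I by (simp add: J_def)
      show "\<exists>k. N (snd j) = p ^ k" if "j \<in> J" for j using N that by (auto simp: J_def)
      show "h ` PiE {..<m} (\<lambda>_. A) \<subseteq> PiE J (\<lambda>j. {0..<int (N (snd j))})"
        using A by (fastforce simp: h_def J_def)
    next
      fix x y z assume mem: "x \<in> h ` PiE {..<m} (\<lambda>_. A)" "y \<in> h ` PiE {..<m} (\<lambda>_. A)" "z \<in> h ` PiE {..<m} (\<lambda>_. A)"
        and ap: "\<And>j. j \<in> J \<Longrightarrow> [x j + y j = 2 * z j] (mod int (N (snd j)))"
      then obtain a b c where abc: "x = h a" "y = h b" "z = h c"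
        "a \<in> PiE {..<m} (\<lambda>_. A)" "b \<in> PiE {..<m} (\<lambda>_. A)" "c \<in> PiE {..<m} (\<lambda>_. A)" by blast
      \<comment> \<open>A solution in the power is a solution in each component \<open>t\<close>,
        and \<open>free\<close> makes each of these constant.\<close>
      have eq: "a t = b t \<and> b t = c t" if t: "t \<in> {..<m}" for t
      proof (rule free)
        show "a t \<in> A" "b t \<in> A" "c t \<in> A" using abc t by auto
        show "[a t i + b t i = 2 * c t i] (mod int (N i))" if "i \<in> I" for i
          using ap[of "(t, i)"] t that abc by (simp add: h_def J_def)
      qed
      have "a = b" using abc(4,5) by (rule PiE_ext) (use eq in auto)
      moreover have "b = c" using abc(5,6) by (rule PiE_ext) (use eq in auto)
      ultimately show "x = y \<and> y = z" using abc by simp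
    qed
    also have "card (h ` PiE {..<m} (\<lambda>_. A)) = card A ^ m"
      using inj by (subst card_image) (auto simp: inj_on_def card_PiE)
    also have "(\<Prod>j\<in>J. kappa (N (snd j))) = (\<Prod>t<m. \<Prod>i\<in>I. kappa (N i))"
      unfolding prod.cartesian_product by (simp add: J_def case_prod_unfold)
    also have "\<dots> = K ^ m" by (simp add: K_def)
    finally show ?thesis by simp
  qed
  have "real (card A) \<le> K"
  proof (rule ccontr)
    assume "\<not> real (card A) \<le> K"
    then have "1 < real (card A) / K" using K by simp
    then obtain m where "3 < (real (card A) / K) ^ m" using real_arch_pow by blast
    then show False using power[of m] K by (simp add: power_divide less_divide_eq)
  qed
  then show ?thesis by (simp add: K_def)
qed

section \<open>Translation to the product of cyclic groups\<close>

theorem theorem5: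
  fixes p n :: nat
    and N :: "nat \<Rightarrow> nat"
    and A :: "(nat \<Rightarrow> int) set"
  assumes "prime p"
    and "odd p"
    and "\<And>i. i \<in> {1..n} \<Longrightarrow> \<exists>k. N i = p ^ k"
    and "A \<subseteq> carrier (product_group {1..n} (\<lambda>i. integer_mod_group (N i)))"
    and "without_three_progressions (product_group {1..n} (\<lambda>i. integer_mod_group (N i))) A"
  shows "real (card A) \<le> (\<Prod>i=1..n. kappa (N i))"
proof (rule progression_free_card_le[OF _ assms(1)])
  let ?I = "{1..n}" and ?G = "product_group {1..n} (\<lambda>i. integer_mod_group (N i))"
  have N: "N i > 0" "odd (N i)" if "i \<in> ?I" for i
    using assms(3)[OF that] assms(2) prime_gt_0_nat[OF assms(1)] by auto
  have A: "A \<subseteq> PiE ?I (\<lambda>i. {0..<int (N i)})"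
  proof -
    have "carrier ?G = PiE ?I (\<lambda>i. {0..<int (N i)})"
      unfolding carrier_product_group
      by (rule PiE_cong) (use N(1) in \<open>simp add: carrier_integer_mod_group\<close>)
    then show ?thesis using assms(4) by simp
  qed
  show "A \<subseteq> PiE ?I (\<lambda>i. {0..<int (N i)})" by (rule A)
  have eqI: "x = y" if "x \<in> A" "y \<in> A" "\<And>i. i \<in> ?I \<Longrightarrow> [x i = y i] (mod int (N i))" for x y
  proof (rule PiE_ext)
    show "x \<in> PiE ?I (\<lambda>i. {0..<int (N i)})" "y \<in> PiE ?I (\<lambda>i. {0..<int (N i)})"
      using that(1,2) A by auto
    fix i assume i: "i \<in> ?I"
    have "x i \<in> {0..<int (N i)}" "y i \<in> {0..<int (N i)}" using that(1,2) A i by fastforce+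
    then show "x i = y i" using that(3)[OF i] by (simp add: cong_def)
  qed
  fix x y z assume xyz: "x \<in> A" "y \<in> A" "z \<in> A"
    and ap: "\<And>i. i \<in> ?I \<Longrightarrow> [x i + y i = 2 * z i] (mod int (N i))"
  have pow: "z [^]\<^bsub>?G\<^esub> (2::nat) = (\<lambda>i\<in>?I. (z i + z i) mod int (N i))"
    by (auto simp: numeral_2_eq_2 fun_eq_iff mod_simps)
  have prog: "x \<otimes>\<^bsub>?G\<^esub> y = z [^]\<^bsub>?G\<^esub> (2::nat)"
    unfolding pow using ap by (auto simp: fun_eq_iff cong_def)
  have "\<not> three_progression ?G x y z"
    using assms(5) xyz unfolding without_three_progressions_def by blast
  \<comment> \<open>Progressions consist of different elements, so their absence only yields that
    two of the three coincide. Each coincidence has to be shown to force the third element to agree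
    as well.\<close>
  then consider "x = y" | "y = z" | "x = z" using prog by (auto simp: three_progression_def)
  then show "x = y \<and> y = z"
  proof cases
    case 1
    have "x = z"
    proof (rule eqI[OF xyz(1,3)])
      fix i assume i: "i \<in> ?I"
      have "[2 * x i = 2 * z i] (mod int (N i))" using ap[OF i] 1 by simp
      \<comment> \<open>Here oddness of \<open>p\<close> enters: with \<open>x = y\<close> the
        equation reads \<open>2 x = 2 z\<close>, and 2 can be cancelled modulo the odd
        \<open>N i\<close>. In the other two cases a plain subtraction suffices.\<close>
      moreover have "coprime 2 (int (N i))" using N[OF i] by simp
      ultimately show "[x i = z i] (mod int (N i))" by (simp add: cong_mult_lcancel)
    qed
    then show ?thesis using 1 by simp
  next
    case 2
    have "x = z"
      by (rule eqI[OF xyz(1,3)]) (use ap 2 in \<open>auto simp: cong_iff_dvd_diff algebra_simps\<close>)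
    then show ?thesis using 2 by simp
  next
    case 3
    have "y = z"
      by (rule eqI[OF xyz(2,3)]) (use ap 3 in \<open>auto simp: cong_iff_dvd_diff algebra_simps\<close>)
    then show ?thesis using 3 by simp
  qed
qed (use assms(3) in auto)

end
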